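(* Let $R$ be a right $WV$-ring which is not a right $V$-ring. Then $R$ is right uniform, i.e. $R_R$ is a uniform module.
   Context: All rings are associative with identity, and all modules are right modules. A ring $R$ is a right $V$-ring if every simple right $R$-module is injective. A ring $R$ is a right $WV$-ring if every simple right $R$-module is $R/A$-injective for every right ideal $A$ of $R$ such that $R/A\not\cong R$ as right $R$-modules. (For modules $N$, $Q$: $Q$ is $N$-injective if every homomorphism from a submodule of $N$ to $Q$ extends to $N$.) A module is uniform if it is nonzero and any two nonzero submodules have nonzero intersection. *)

theory Defs
  imports "HOL-Algebra.Module" "HOL-Algebra.AbelCoset"
begin

text \<open>
  The library locale \<open>module\<close> requires a commutative ring of scalars, so right modules over an
  arbitrary ring are introduced here. The library's module record and its locale \<open>submodule\<close>
  (which does not mention commutativity) are reused. Since the record writes the scalar first,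
  \<open>a \<odot>\<^bsub>M\<^esub> x\<close> stands for the right action \<open>x a\<close>; this is why the law \<open>x (a b) = (x a) b\<close>
  appears below with \<open>a\<close> and \<open>b\<close> exchanged on the right-hand side. The fields \<open>mult\<close> and
  \<open>one\<close> of a module record carry no meaning.
\<close>

locale right_module = R?: ring R + M?: abelian_group M
  for R :: "('a, 'm) ring_scheme" (structure) and M :: "('a, 'b, 'c) module_scheme" (structure) +
  assumes smult_closed [simp, intro]:
      "\<lbrakk>a \<in> carrier R; x \<in> carrier M\<rbrakk> \<Longrightarrow> a \<odot>\<^bsub>M\<^esub> x \<in> carrier M"
    and smult_l_distr:
      "\<lbrakk>a \<in> carrier R; b \<in> carrier R; x \<in> carrier M\<rbrakk> \<Longrightarrow>
      (a \<oplus>\<^bsub>R\<^esub> b) \<odot>\<^bsub>M\<^esub> x = a \<odot>\<^bsub>M\<^esub> x \<oplus>\<^bsub>M\<^esub> b \<odot>\<^bsub>M\<^esub> x"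
    and smult_r_distr:
      "\<lbrakk>a \<in> carrier R; x \<in> carrier M; y \<in> carrier M\<rbrakk> \<Longrightarrow>
      a \<odot>\<^bsub>M\<^esub> (x \<oplus>\<^bsub>M\<^esub> y) = a \<odot>\<^bsub>M\<^esub> x \<oplus>\<^bsub>M\<^esub> a \<odot>\<^bsub>M\<^esub> y"
    and smult_assoc1:
      "\<lbrakk>a \<in> carrier R; b \<in> carrier R; x \<in> carrier M\<rbrakk> \<Longrightarrow>
      (a \<otimes>\<^bsub>R\<^esub> b) \<odot>\<^bsub>M\<^esub> x = b \<odot>\<^bsub>M\<^esub> (a \<odot>\<^bsub>M\<^esub> x)"
    and smult_one [simp]:
      "x \<in> carrier M \<Longrightarrow> \<one>\<^bsub>R\<^esub> \<odot>\<^bsub>M\<^esub> x = x"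

definition right_module_hom ::
    "('a, 'm) ring_scheme \<Rightarrow> ('a, 'b, 'k) module_scheme \<Rightarrow> ('a, 'c, 'l) module_scheme \<Rightarrow> ('b \<Rightarrow> 'c) set"
  where "right_module_hom R M N =
    {f \<in> hom (add_monoid M) (add_monoid N).
      \<forall>a\<in>carrier R. \<forall>x\<in>carrier M. f (a \<odot>\<^bsub>M\<^esub> x) = a \<odot>\<^bsub>N\<^esub> f x}"

definition right_module_isomorphic ::
    "('a, 'm) ring_scheme \<Rightarrow> ('a, 'b, 'k) module_scheme \<Rightarrow> ('a, 'c, 'l) module_scheme \<Rightarrow> bool"
  where "right_module_isomorphic R M N \<longleftrightarrow>
    (\<exists>f \<in> right_module_hom R M N. bij_betw f (carrier M) (carrier N))"

definition simple_right_module ::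
    "('a, 'm) ring_scheme \<Rightarrow> ('a, 'b, 'k) module_scheme \<Rightarrow> bool"
  where "simple_right_module R S \<longleftrightarrow>
    right_module R S \<and> carrier S \<noteq> {\<zero>\<^bsub>S\<^esub>} \<and>
    (\<forall>H. submodule H R S \<longrightarrow> H = {\<zero>\<^bsub>S\<^esub>} \<or> H = carrier S)"

definition uniform_right_module ::
    "('a, 'm) ring_scheme \<Rightarrow> ('a, 'b, 'k) module_scheme \<Rightarrow> bool"
  where "uniform_right_module R M \<longleftrightarrow>
    right_module R M \<and> carrier M \<noteq> {\<zero>\<^bsub>M\<^esub>} \<and>
    (\<forall>H K. submodule H R M \<and> submodule K R M \<and> H \<noteq> {\<zero>\<^bsub>M\<^esub>} \<and> K \<noteq> {\<zero>\<^bsub>M\<^esub>} \<longrightarrow>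
      H \<inter> K \<noteq> {\<zero>\<^bsub>M\<^esub>})"

definition relatively_injective ::
    "('a, 'm) ring_scheme \<Rightarrow> ('a, 'b, 'k) module_scheme \<Rightarrow> ('a, 'c, 'l) module_scheme \<Rightarrow> bool"
    \<comment> \<open>\<open>relatively_injective R N Q\<close>: the module \<open>Q\<close> is \<open>N\<close>-injective\<close>
  where "relatively_injective R N Q \<longleftrightarrow>
    (\<forall>H. submodule H R N \<longrightarrow>
      (\<forall>f \<in> right_module_hom R (N\<lparr>carrier := H\<rparr>) Q.
        \<exists>g \<in> right_module_hom R N Q. \<forall>x\<in>H. g x = f x))"

text \<open>
  A formula cannot quantify over types, so the notions below that refer to all modules take the
  types of the elements of these modules as arguments: \<open>'n\<close> for the test modules in the
  definition of injectivity, \<open>'s\<close> for the simple modules.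
\<close>

definition injective_right_module ::
    "'n itself \<Rightarrow> ('a, 'm) ring_scheme \<Rightarrow> ('a, 'b, 'k) module_scheme \<Rightarrow> bool"
  where "injective_right_module (_ :: 'n itself) R Q \<longleftrightarrow>
    (\<forall>N :: ('a, 'n) module. right_module R N \<longrightarrow> relatively_injective R N Q)"

definition regular_right_module :: "('a, 'm) ring_scheme \<Rightarrow> ('a, 'a) module"
  where "regular_right_module R =
    \<lparr>carrier = carrier R, mult = mult R, one = \<one>\<^bsub>R\<^esub>, zero = \<zero>\<^bsub>R\<^esub>, add = add R,
     smult = (\<lambda>a x. x \<otimes>\<^bsub>R\<^esub> a)\<rparr>"

text \<open>
  As in the library's quotient rings, the operations on cosets are defined without choosing
  representatives: the action of \<open>a\<close> sends \<open>H + x\<close> to the union of all \<open>H + y a\<close> with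
  \<open>y \<in> H + x\<close>, which is \<open>H + x a\<close>.
\<close>

definition quotient_right_module ::
    "('a, 'b, 'k) module_scheme \<Rightarrow> 'b set \<Rightarrow> ('a, 'b set) module"
  where "quotient_right_module M H =
    \<lparr>carrier = a_rcosets\<^bsub>M\<^esub> H, mult = undefined, one = undefined, zero = H, add = set_add M,
     smult = (\<lambda>a X. \<Union>x\<in>X. H +>\<^bsub>M\<^esub> (a \<odot>\<^bsub>M\<^esub> x))\<rparr>"

abbreviation right_ideal :: "'a set \<Rightarrow> ('a, 'm) ring_scheme \<Rightarrow> bool"
  where "right_ideal A R \<equiv> submodule A R (regular_right_module R)"

text \<open>
  For \<open>right_V_ring\<close> both types matter, since a small type may carry too few modules. The full
  notion demands the property at all types. Hence a ring fails to be a right V-ring if and only if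
  \<open>right_V_ring\<close> fails at some choice of \<open>'s\<close> and \<open>'n\<close>, and a theorem with the hypothesis
  \<open>\<not> right_V_ring TYPE('s) TYPE('n) R\<close> for type variables \<open>'s\<close> and \<open>'n\<close> not occurring
  elsewhere covers all rings that are not right V-rings.
\<close>

definition right_V_ring :: "'s itself \<Rightarrow> 'n itself \<Rightarrow> ('a, 'm) ring_scheme \<Rightarrow> bool"
  where "right_V_ring (_ :: 's itself) (_ :: 'n itself) R \<longleftrightarrow>
    (\<forall>S :: ('a, 's) module. simple_right_module R S \<longrightarrow> injective_right_module TYPE('n) R S)"

definition right_WV_ring :: "'s itself \<Rightarrow> ('a, 'm) ring_scheme \<Rightarrow> bool"
  where "right_WV_ring (_ :: 's itself) R \<longleftrightarrow>
    (\<forall>S :: ('a, 's) module. simple_right_module R S \<longrightarrow>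
      (\<forall>A. right_ideal A R \<and>
        \<not> right_module_isomorphic R
            (quotient_right_module (regular_right_module R) A) (regular_right_module R) \<longrightarrow>
        relatively_injective R (quotient_right_module (regular_right_module R) A) S))"

lemma regular_right_module_simps [simp]:
  "carrier (regular_right_module R) = carrier R"
  "add (regular_right_module R) = add R"
  "zero (regular_right_module R) = zero R"
  "smult (regular_right_module R) a x = x \<otimes>\<^bsub>R\<^esub> a"
  by (simp_all add: regular_right_module_def)

lemma right_module_regular:
  assumes "ring R" shows "right_module R (regular_right_module R)"
proof -
  interpret ring R by fact
  have 1: "comm_group (add_monoid (regular_right_module R))"
    by (rule comm_groupI) (auto simp: a_ac intro: l_neg add.l_inv_ex)
  show ?thesis
    apply (intro right_module.intro assms abelian_group.intro abelian_monoid.intro abelian_group_axioms.intro 1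
       right_module_axioms.intro comm_group.axioms(1)[OF 1])
    apply (auto simp: r_distr l_distr m_assoc)
    done
qed

context right_module
begin

lemma smult_r_zero: "a \<in> carrier R \<Longrightarrow> a \<odot>\<^bsub>M\<^esub> \<zero>\<^bsub>M\<^esub> = \<zero>\<^bsub>M\<^esub>"
  using smult_r_distr[of a "\<zero>\<^bsub>M\<^esub>" "\<zero>\<^bsub>M\<^esub>"] by (metis M.zero_closed M.r_zero smult_closed M.add.r_cancel_one)

lemma coset_smult:
  assumes H: "submodule H R M" and a: "a \<in> carrier R" and x: "x \<in> carrier M"
  shows "(\<Union>y\<in>H +>\<^bsub>M\<^esub> x. H +>\<^bsub>M\<^esub> (a \<odot>\<^bsub>M\<^esub> y)) = H +>\<^bsub>M\<^esub> (a \<odot>\<^bsub>M\<^esub> x)"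
proof -
  have sg: "subgroup H (add_monoid M)" using H by (simp add: submodule_def)
  have Hc: "H \<subseteq> carrier M" using subgroup.subset[OF sg] by simp
  have "H +>\<^bsub>M\<^esub> (a \<odot>\<^bsub>M\<^esub> y) = H +>\<^bsub>M\<^esub> (a \<odot>\<^bsub>M\<^esub> x)" if yx: "y \<in> H +>\<^bsub>M\<^esub> x" for y
  proof -
    obtain h where h: "h \<in> H" "y = h \<oplus>\<^bsub>M\<^esub> x" using yx by (auto simp: a_r_coset_defs)
    have hc: "h \<in> carrier M" using h Hc by auto
    have 1: "a \<odot>\<^bsub>M\<^esub> y = a \<odot>\<^bsub>M\<^esub> h \<oplus>\<^bsub>M\<^esub> a \<odot>\<^bsub>M\<^esub> x" using h hc a x by (simp add: smult_r_distr)
    have ah: "a \<odot>\<^bsub>M\<^esub> h \<in> H" using submodule.smult_closed[OF H a h(1)] .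
    have "a \<odot>\<^bsub>M\<^esub> y \<in> H +>\<^bsub>M\<^esub> (a \<odot>\<^bsub>M\<^esub> x)" unfolding 1 using ah by (auto simp: a_r_coset_defs)
    then show ?thesis
      using group.repr_independence[OF M.a_group, of "a \<odot>\<^bsub>M\<^esub> y" H "a \<odot>\<^bsub>M\<^esub> x"] sg a x
      by (simp add: a_r_coset_def)
  qed
  moreover have "x \<in> H +>\<^bsub>M\<^esub> x" using group.rcos_self[OF M.a_group, of x H] sg x by (simp add: a_r_coset_def)
  ultimately show ?thesis by blast
qed

lemma right_module_quotient:
  assumes H: "submodule H R M" shows "right_module R (quotient_right_module M H)"
proof -
  let ?Q = "quotient_right_module M H"
  have sg: "subgroup H (add_monoid M)" using H by (simp add: submodule_def)
  have Hc: "H \<subseteq> carrier M" using subgroup.subset[OF sg] by simp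
  have as: "abelian_subgroup H M"
    by (intro abelian_subgroupI3 additive_subgroup.intro sg M.abelian_group_axioms)
  interpret H: abelian_subgroup H M by (rule as)
  have qs: "carrier ?Q = a_rcosets\<^bsub>M\<^esub> H" "zero ?Q = H" "add ?Q = set_add M"
     "\<And>a X. smult ?Q a X = (\<Union>x\<in>X. H +>\<^bsub>M\<^esub> (a \<odot>\<^bsub>M\<^esub> x))" by (simp_all add: quotient_right_module_def)
  have c: "\<exists>x\<in>carrier M. X = H +>\<^bsub>M\<^esub> x" if "X \<in> a_rcosets\<^bsub>M\<^esub> H" for X 
    using that by (auto simp: A_RCOSETS_def RCOSETS_def a_r_coset_def)
  have ci: "x\<in>carrier M \<Longrightarrow> H +>\<^bsub>M\<^esub> x \<in> a_rcosets\<^bsub>M\<^esub> H" for x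
    by (auto simp: A_RCOSETS_def RCOSETS_def a_r_coset_def)
  interpret F: comm_group "M A_Mod H" by (rule H.a_factorgroup_is_comm_group)
  have F: "carrier (M A_Mod H) = a_rcosets\<^bsub>M\<^esub> H" "mult (M A_Mod H) = set_add M" "one (M A_Mod H) = H"
    by (simp_all add: A_FactGroup_def FactGroup_def A_RCOSETS_def set_add_def)
  have 1: "comm_group (add_monoid ?Q)"
    by (rule comm_groupI)
      (use F.m_closed F.one_closed F.m_assoc F.m_comm F.l_one F.l_inv_ex in \<open>simp_all add: F qs\<close>)
  have "right_module_axioms R ?Q"
  proof (unfold_locales, goal_cases)
    case (1 a x) then show ?case using c[of x] by (auto simp: qs coset_smult[OF H] ci)
  next
    case (2 a b x)
    then obtain u where u: "u \<in> carrier M" "x = H +>\<^bsub>M\<^esub> u" using c[of x] by (auto simp: qs)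
    then show ?case
      using 2 coset_smult[OF H _ u(1)] by (simp add: qs H.a_rcos_sum smult_l_distr[of a b u])
  next
    case (3 a x y)
    then obtain u v where u: "u \<in> carrier M" "x = H +>\<^bsub>M\<^esub> u"
      and v: "v \<in> carrier M" "y = H +>\<^bsub>M\<^esub> v" using c[of x] c[of y] by (auto simp: qs)
    then show ?case
      using 3 coset_smult[OF H _ u(1)] coset_smult[OF H _ v(1)]
        coset_smult[OF H _ M.a_closed[OF u(1) v(1)]]
      by (simp add: qs H.a_rcos_sum smult_r_distr[of a u v])
  next
    case (4 a b x)
    then obtain u where u: "u \<in> carrier M" "x = H +>\<^bsub>M\<^esub> u" using c[of x] by (auto simp: qs)
    then show ?case
      using 4 coset_smult[OF H _ u(1)] coset_smult[OF H _ smult_closed[OF 4(1) u(1)]]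
      by (simp add: qs smult_assoc1[of a b u])
  next
    case (5 x)
    then obtain u where u: "u \<in> carrier M" "x = H +>\<^bsub>M\<^esub> u" using c[of x] by (auto simp: qs)
    then show ?case using coset_smult[OF H _ u(1)] by (simp add: qs)
  qed
  then show ?thesis
    by (intro right_module.intro abelian_group.intro abelian_monoid.intro abelian_group_axioms.intro 1
       comm_group.axioms(1)[OF 1] R.ring_axioms) 
qed

end

lemma right_module_homD:
  assumes "f \<in> right_module_hom R M N"
  shows "x \<in> carrier M \<Longrightarrow> f x \<in> carrier N"
    "x \<in> carrier M \<Longrightarrow> y \<in> carrier M \<Longrightarrow> f (x \<oplus>\<^bsub>M\<^esub> y) = f x \<oplus>\<^bsub>N\<^esub> f y"
    "a \<in> carrier R \<Longrightarrow> x \<in> carrier M \<Longrightarrow> f (a \<odot>\<^bsub>M\<^esub> x) = a \<odot>\<^bsub>N\<^esub> f x"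
  using assms by (auto simp: right_module_hom_def hom_def)

lemma right_module_homI:
  assumes "\<And>x. x \<in> carrier M \<Longrightarrow> f x \<in> carrier N"
    "\<And>x y. x \<in> carrier M \<Longrightarrow> y \<in> carrier M \<Longrightarrow> f (x \<oplus>\<^bsub>M\<^esub> y) = f x \<oplus>\<^bsub>N\<^esub> f y"
    "\<And>a x. a \<in> carrier R \<Longrightarrow> x \<in> carrier M \<Longrightarrow> f (a \<odot>\<^bsub>M\<^esub> x) = a \<odot>\<^bsub>N\<^esub> f x"
  shows "f \<in> right_module_hom R M N"
  using assms by (auto simp: right_module_hom_def hom_def)

lemma right_module_hom_comp:
  assumes "f \<in> right_module_hom R M N" "g \<in> right_module_hom R N P"
  shows "g \<circ> f \<in> right_module_hom R M P"
  using assms by (auto simp: right_module_hom_def hom_def Pi_def)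

lemma right_module_hom_zero:
  assumes "right_module R M" "right_module R N" "f \<in> right_module_hom R M N"
  shows "f \<zero>\<^bsub>M\<^esub> = \<zero>\<^bsub>N\<^esub>"
proof -
  interpret M: right_module R M by fact
  interpret N: right_module R N by fact
  have "f \<zero>\<^bsub>M\<^esub> \<in> carrier N" "f \<zero>\<^bsub>M\<^esub> \<oplus>\<^bsub>N\<^esub> f \<zero>\<^bsub>M\<^esub> = f \<zero>\<^bsub>M\<^esub>"
    using right_module_homD[OF assms(3)] M.M.zero_closed M.M.r_zero by metis+
  then show ?thesis using N.M.add.l_cancel_one by blast
qed

lemma right_module_hom_inv_into:
  assumes M: "right_module R M" and N: "right_module R N" and f: "f \<in> right_module_hom R M N"
    and b: "bij_betw f (carrier M) (carrier N)"
  shows "inv_into (carrier M) f \<in> right_module_hom R N M"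
proof -
  interpret M: right_module R M by fact
  interpret N: right_module R N by fact
  let ?g = "inv_into (carrier M) f"
  have gc: "?g y \<in> carrier M" if "y \<in> carrier N" for y
    using b that by (metis bij_betw_imp_surj_on inv_into_into)
  have fg: "f (?g y) = y" if "y \<in> carrier N" for y
    using b that by (metis bij_betw_inv_into_right)
  have gf: "?g (f x) = x" if "x \<in> carrier M" for x
    using b that by (metis bij_betw_inv_into_left)
  show ?thesis
  proof (rule right_module_homI)
    fix x y assume "x \<in> carrier N" "y \<in> carrier N"
    then show "?g (x \<oplus>\<^bsub>N\<^esub> y) = ?g x \<oplus>\<^bsub>M\<^esub> ?g y"
      using gf[of "?g x \<oplus>\<^bsub>M\<^esub> ?g y"] by (simp add: right_module_homD[OF f] gc fg)
  next
    fix a y assume "a \<in> carrier R" "y \<in> carrier N"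
    then show "?g (a \<odot>\<^bsub>N\<^esub> y) = a \<odot>\<^bsub>M\<^esub> ?g y"
      using gf[of "a \<odot>\<^bsub>M\<^esub> ?g y"] by (simp add: right_module_homD[OF f] gc fg)
  qed (rule gc)
qed

lemma right_submoduleI:
  assumes M: "right_module R M" and "H \<subseteq> carrier M" "\<zero>\<^bsub>M\<^esub> \<in> H"
    and add: "\<And>x y. x \<in> H \<Longrightarrow> y \<in> H \<Longrightarrow> x \<oplus>\<^bsub>M\<^esub> y \<in> H"
    and smult: "\<And>a x. a \<in> carrier R \<Longrightarrow> x \<in> H \<Longrightarrow> a \<odot>\<^bsub>M\<^esub> x \<in> H"
  shows "submodule H R M"
proof -
  interpret M: right_module R M by fact
  have neg: "\<ominus>\<^bsub>M\<^esub> x \<in> H" if x: "x \<in> H" for x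
  proof -
    have xc: "x \<in> carrier M" using x assms by auto
    have "(\<ominus>\<^bsub>R\<^esub> \<one>\<^bsub>R\<^esub>) \<odot>\<^bsub>M\<^esub> x \<oplus>\<^bsub>M\<^esub> x = (\<ominus>\<^bsub>R\<^esub> \<one>\<^bsub>R\<^esub> \<oplus>\<^bsub>R\<^esub> \<one>\<^bsub>R\<^esub>) \<odot>\<^bsub>M\<^esub> x"
      using xc M.smult_l_distr[of "\<ominus>\<^bsub>R\<^esub> \<one>\<^bsub>R\<^esub>" "\<one>\<^bsub>R\<^esub>" x] by simp
    also have "\<dots> = \<zero>\<^bsub>R\<^esub> \<odot>\<^bsub>M\<^esub> x" by (simp add: M.R.l_neg)
    also have "\<dots> = \<zero>\<^bsub>M\<^esub>" 
      using M.smult_l_distr[of "\<zero>\<^bsub>R\<^esub>" "\<zero>\<^bsub>R\<^esub>" x] xc by (metis M.R.zero_closed M.R.r_zero M.smult_closed M.M.add.l_cancel_one)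
    finally have "\<ominus>\<^bsub>M\<^esub> x = (\<ominus>\<^bsub>R\<^esub> \<one>\<^bsub>R\<^esub>) \<odot>\<^bsub>M\<^esub> x"
      using xc by (metis M.M.minus_equality M.R.a_inv_closed M.R.one_closed M.smult_closed)
    then show ?thesis using smult[of "\<ominus>\<^bsub>R\<^esub> \<one>\<^bsub>R\<^esub>" x] x by simp
  qed
  show ?thesis
    by (intro submodule.intro submodule_axioms.intro group.subgroupI[OF M.M.a_group])
      (use assms neg in \<open>auto simp: a_inv_def\<close>)
qed

lemma right_submoduleD:
  assumes "submodule H R M"
  shows "H \<subseteq> carrier M" "\<zero>\<^bsub>M\<^esub> \<in> H" "x \<in> H \<Longrightarrow> y \<in> H \<Longrightarrow> x \<oplus>\<^bsub>M\<^esub> y \<in> H"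
    "a \<in> carrier R \<Longrightarrow> x \<in> H \<Longrightarrow> a \<odot>\<^bsub>M\<^esub> x \<in> H"
  using assms subgroup.subset[of H "add_monoid M"] subgroup.one_closed[of H "add_monoid M"]
    subgroup.m_closed[of H "add_monoid M" x y] submodule.smult_closed[OF assms, of a x] 
  by (auto simp: submodule_def)

lemma right_submodule_image:
  assumes M: "right_module R M" and N: "right_module R N" and f: "f \<in> right_module_hom R M N"
    and H: "submodule H R M"
  shows "submodule (f ` H) R N"
proof (rule right_submoduleI[OF N])
  note H' = right_submoduleD[OF H]
  note f' = right_module_homD[OF f]
  show "f ` H \<subseteq> carrier N" using H'(1) f'(1) by auto
  show "\<zero>\<^bsub>N\<^esub> \<in> f ` H" using right_module_hom_zero[OF M N f] H'(2) by (metis imageI)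
  show "x \<oplus>\<^bsub>N\<^esub> y \<in> f ` H" if "x \<in> f ` H" "y \<in> f ` H" for x y
    using that f'(2) H'(1,3) by (auto simp: subset_iff image_iff) metis
  show "a \<odot>\<^bsub>N\<^esub> y \<in> f ` H" if "a \<in> carrier R" "y \<in> f ` H" for a y
    using that f'(3) H'(1,4) by (auto simp: subset_iff image_iff) metis
qed

lemma simple_right_module_iso:
  assumes M: "simple_right_module R M" and N: "right_module R N" and f: "f \<in> right_module_hom R N M"
    and b: "bij_betw f (carrier N) (carrier M)"
  shows "simple_right_module R N"
  unfolding simple_right_module_def
proof (intro conjI allI impI)
  have M': "right_module R M" using M by (simp add: simple_right_module_def)
  note z = right_module_hom_zero[OF N M' f]
  have zN: "\<zero>\<^bsub>N\<^esub> \<in> carrier N" using N by (simp add: right_module_def abelian_group_def abelian_monoid.zero_closed)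
  show "carrier N \<noteq> {\<zero>\<^bsub>N\<^esub>}"
    using M b z by (auto simp: simple_right_module_def bij_betw_def)
  fix H assume H: "submodule H R N"
  have "f ` H = {\<zero>\<^bsub>M\<^esub>} \<or> f ` H = carrier M"
    using M right_submodule_image[OF N M' f H] by (simp add: simple_right_module_def)
  moreover have "inj_on f (carrier N)" "f ` carrier N = carrier M" using b by (auto simp: bij_betw_def)
  ultimately show "H = {\<zero>\<^bsub>N\<^esub>} \<or> H = carrier N"
    using right_submoduleD(1)[OF H] zN z inj_on_image_eq_iff[of f "carrier N" H] 
      inj_on_image_eq_iff[of f "carrier N" H "{\<zero>\<^bsub>N\<^esub>}"] by (metis empty_subsetI image_empty image_insert insert_subset subset_refl)
qed (use N in simp)

lemma relatively_injective_iso: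
  assumes M: "right_module R M" and N: "right_module R N" and f: "f \<in> right_module_hom R N M"
    and b: "bij_betw f (carrier N) (carrier M)"
    and inj: "relatively_injective R P N"
  shows "relatively_injective R P M"
  unfolding relatively_injective_def
proof (intro allI impI ballI)
  fix H h assume H: "submodule H R P" and h: "h \<in> right_module_hom R (P\<lparr>carrier := H\<rparr>) M"
  let ?k = "inv_into (carrier N) f"
  have k: "?k \<in> right_module_hom R M N" by (rule right_module_hom_inv_into[OF N M f b])
  obtain g where g: "g \<in> right_module_hom R P N" "\<forall>x\<in>H. g x = (?k \<circ> h) x"
    using inj H right_module_hom_comp[OF h k] unfolding relatively_injective_def by blast
  have "f (?k (h x)) = h x" if "x \<in> H" for x
    using b right_module_homD(1)[OF h, of x] that by (simp add: bij_betw_inv_into_right)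
  then show "\<exists>g\<in>right_module_hom R P M. \<forall>x\<in>H. g x = h x"
    by (intro bexI[of _ "f \<circ> g"]) (use right_module_hom_comp[OF g(1) f] g(2) in auto)
qed

lemma simple_right_module_quotient:
  assumes S: "simple_right_module R (S :: ('a, 's, 'k) module_scheme)"
  obtains S' :: "('a, 'a set) module" and f
  where "right_module R S'" "f \<in> right_module_hom R S' S" "bij_betw f (carrier S') (carrier S)"
proof -
  interpret S: right_module R S using S by (simp add: simple_right_module_def)
  interpret RR: right_module R "regular_right_module R" by (rule right_module_regular) (rule S.R.ring_axioms)
  obtain x where x: "x \<in> carrier S" "x \<noteq> \<zero>\<^bsub>S\<^esub>"
    using S S.M.zero_closed by (auto simp: simple_right_module_def)
  define p where "p a = a \<odot>\<^bsub>S\<^esub> x" for a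
  have p: "p \<in> right_module_hom R (regular_right_module R) S"
    by (rule right_module_homI) (auto simp: p_def x S.smult_l_distr S.smult_assoc1)
  note p' = right_module_homD[OF p, simplified]
  have p0: "p \<zero>\<^bsub>R\<^esub> = \<zero>\<^bsub>S\<^esub>" using right_module_hom_zero[OF RR.right_module_axioms S.right_module_axioms p] by simp
  have "submodule (carrier R) R (regular_right_module R)"
    by (rule right_submoduleI[OF RR.right_module_axioms]) auto
  from right_submodule_image[OF RR.right_module_axioms S.right_module_axioms p this]
  have "p ` carrier R = {\<zero>\<^bsub>S\<^esub>} \<or> p ` carrier R = carrier S" using S by (simp add: simple_right_module_def)
  moreover have "p \<one>\<^bsub>R\<^esub> = x" by (simp add: p_def x)
  ultimately have surj: "p ` carrier R = carrier S" using x(2) S.R.one_closed by (metis imageI singletonD)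
  define K where "K = {a \<in> carrier R. p a = \<zero>\<^bsub>S\<^esub>}"
  have K: "submodule K R (regular_right_module R)"
    by (rule right_submoduleI[OF RR.right_module_axioms]) (auto simp: K_def p' p0 S.smult_r_zero)
  let ?Q = "quotient_right_module (regular_right_module R) K"
  have Q: "right_module R ?Q" by (rule RR.right_module_quotient[OF K])
  have as: "abelian_subgroup K (regular_right_module R)"
    using K by (intro abelian_subgroupI3 additive_subgroup.intro RR.M.abelian_group_axioms) (simp add: submodule_def)
  interpret K: abelian_subgroup K "regular_right_module R" by (rule as)
  let ?c = "\<lambda>a. K +>\<^bsub>regular_right_module R\<^esub> a"
  have car: "carrier ?Q = ?c ` carrier R"
    by (auto simp: quotient_right_module_def A_RCOSETS_def RCOSETS_def a_r_coset_def)
  have pK: "p b = p a" if "a \<in> carrier R" "b \<in> ?c a" for a b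
    using that by (auto simp: a_r_coset_defs K_def p')
  have self: "a \<in> ?c a" if "a \<in> carrier R" for a
    using K.a_rcos_self[of a] that by simp
  define f where "f X = p (SOME a. a \<in> X)" for X
  have fc: "f (?c a) = p a" if "a \<in> carrier R" for a
    unfolding f_def using pK[OF that] self[OF that] by (metis someI_ex)
  have f: "f \<in> right_module_hom R ?Q S"
  proof (rule right_module_homI)
    fix X assume "X \<in> carrier ?Q" then show "f X \<in> carrier S" by (auto simp: car fc p')
  next
    fix X Y assume "X \<in> carrier ?Q" "Y \<in> carrier ?Q"
    then obtain a b where ab: "a \<in> carrier R" "b \<in> carrier R" "X = ?c a" "Y = ?c b" by (auto simp: car)
    have "X \<oplus>\<^bsub>?Q\<^esub> Y = ?c (a \<oplus>\<^bsub>R\<^esub> b)"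
      using K.a_rcos_sum[of a b] ab by (simp add: quotient_right_module_def)
    then show "f (X \<oplus>\<^bsub>?Q\<^esub> Y) = f X \<oplus>\<^bsub>S\<^esub> f Y" using ab by (simp add: fc p')
  next
    fix r X assume r: "r \<in> carrier R" "X \<in> carrier ?Q"
    then obtain a where a: "a \<in> carrier R" "X = ?c a" by (auto simp: car)
    have "r \<odot>\<^bsub>?Q\<^esub> X = ?c (a \<otimes>\<^bsub>R\<^esub> r)"
      using RR.coset_smult[OF K, of r a] r a by (simp add: quotient_right_module_def)
    then show "f (r \<odot>\<^bsub>?Q\<^esub> X) = r \<odot>\<^bsub>S\<^esub> f X" using r a by (simp add: fc p')
  qed
  have "inj_on f (carrier ?Q)"
  proof (rule inj_onI)
    fix X Y assume XY: "X \<in> carrier ?Q" "Y \<in> carrier ?Q" "f X = f Y"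
    then obtain a b where ab: "a \<in> carrier R" "b \<in> carrier R" "X = ?c a" "Y = ?c b" by (auto simp: car)
    have e: "p a = p b" using XY ab by (simp add: fc)
    define d where "d = a \<ominus>\<^bsub>R\<^esub> b"
    have d: "d \<in> carrier R" "a = d \<oplus>\<^bsub>R\<^esub> b" using ab by (auto simp: d_def a_minus_def S.R.a_assoc S.R.l_neg)
    have "p d \<oplus>\<^bsub>S\<^esub> p b = p b" using e d ab p'(2) by metis
    then have "p d = \<zero>\<^bsub>S\<^esub>" using d(1) ab(2) p'(1) by (metis S.M.add.r_cancel_one)
    then have "a \<in> ?c b" using d by (auto simp: a_r_coset_defs K_def)
    then show "X = Y" 
      using group.repr_independence[OF RR.M.a_group, of a K b] K ab by (simp add: a_r_coset_def submodule_def)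
  qed
  moreover have "f ` carrier ?Q = carrier S"
    unfolding surj[symmetric] car image_image by (rule image_cong) (simp_all add: fc)
  ultimately have "bij_betw f (carrier ?Q) (carrier S)" by (simp add: bij_betw_def)
  with Q f show thesis by (rule that)
qed

text \<open>
  For the property of being a right WV-ring, \<open>'s = 'a set\<close> is no restriction: every simple right
  module is isomorphic to a quotient of the ring, whose elements are sets of ring elements.
\<close>

lemma right_WV_ring_all_types:
  assumes "right_WV_ring TYPE('a set) (R :: ('a, 'm) ring_scheme)"
  shows "right_WV_ring TYPE('s) R"
  unfolding right_WV_ring_def
proof (intro allI impI, elim conjE)
  fix S :: "('a, 's) module" and A
  assume S: "simple_right_module R S" and A: "right_ideal A R"
    and niso: "\<not> right_module_isomorphic R (quotient_right_module (regular_right_module R) A) (regular_right_module R)"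
  have S': "right_module R S" using S by (simp add: simple_right_module_def)
  obtain T :: "('a, 'a set) module" and f
    where T: "right_module R T" "f \<in> right_module_hom R T S" "bij_betw f (carrier T) (carrier S)"
    using simple_right_module_quotient[OF S] .
  have "simple_right_module R T" using simple_right_module_iso[OF S T] .
  with assms A niso have "relatively_injective R (quotient_right_module (regular_right_module R) A) T"
    unfolding right_WV_ring_def by blast
  then show "relatively_injective R (quotient_right_module (regular_right_module R) A) S"
    by (rule relatively_injective_iso[OF S' T])
qed

end

theory Submission
  imports Defs "HOL-Library.Infinite_Set"
begin

text \<open>
  If nonzero right ideals \<open>A\<close>, \<open>B\<close> satisfy \<open>A \<inter> B = 0\<close> and neither \<open>R/A\<close> nor \<open>R/B\<close> is isomorphic
  to \<open>R\<close>, then every simple module is injective relative to \<open>R/A \<oplus> R/B\<close>, hence relative to \<open>R\<close>,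
  and so injective by Baer's criterion. If instead \<open>R/A \<cong> R\<close> for a nonzero right ideal \<open>A\<close>, then
  \<open>A\<close> is the annihilator of some \<open>x\<close> with \<open>x y = 1 \<noteq> y x\<close>. The orthogonal idempotents
  \<open>y\<^sup>i (1 - y x) x\<^sup>i\<close> then generate an infinite direct sum of right ideals. Its even and odd parts
  are not finitely generated, so their quotients are not projective, and they can replace \<open>A\<close>
  and \<open>B\<close>.
\<close>

subsection \<open>Submodules, homomorphisms and quotients\<close>

lemma (in abelian_group) minus_eq_iff:
  assumes "x \<in> carrier G" "y \<in> carrier G" "z \<in> carrier G"
  shows "x \<ominus> y = z \<longleftrightarrow> x = z \<oplus> y"
proof
  assume "x \<ominus> y = z"
  then show "x = z \<oplus> y" using assms by (auto simp: a_minus_def a_assoc l_neg)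
next
  assume "x = z \<oplus> y"
  then show "x \<ominus> y = z" using assms by (simp add: a_minus_def a_assoc r_neg)
qed

lemma right_module_submodule:
  assumes M: "right_module R M" and H: "submodule H R M"
  shows "right_module R (M\<lparr>carrier := H\<rparr>)"
proof -
  interpret M: right_module R M by fact
  note H' = right_submoduleD[OF H]
  have sg: "subgroup H (add_monoid M)" using H by (simp add: submodule_def)
  have Hc: "x \<in> carrier M" if "x \<in> H" for x using H'(1) that by auto
  have 1: "comm_group (add_monoid (M\<lparr>carrier := H\<rparr>))"
  proof (rule comm_groupI)
    fix x assume x: "x \<in> carrier (add_monoid (M\<lparr>carrier := H\<rparr>))"
    then have "\<ominus>\<^bsub>M\<^esub> x \<in> H" using subgroup.m_inv_closed[OF sg] by (simp add: a_inv_def)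
    with x Hc show "\<exists>y\<in>carrier (add_monoid (M\<lparr>carrier := H\<rparr>)).
        y \<otimes>\<^bsub>add_monoid (M\<lparr>carrier := H\<rparr>)\<^esub> x = \<one>\<^bsub>add_monoid (M\<lparr>carrier := H\<rparr>)\<^esub>"
      by (intro bexI[of _ "\<ominus>\<^bsub>M\<^esub> x"]) (auto simp: M.M.l_neg)
  qed (use H' Hc in \<open>auto simp: M.M.a_ac\<close>)
  have "right_module_axioms R (M\<lparr>carrier := H\<rparr>)"
    by unfold_locales
      (use H' Hc in \<open>auto simp: M.smult_l_distr M.smult_r_distr M.smult_assoc1\<close>)
  then show ?thesis
    by (intro right_module.intro abelian_group.intro abelian_monoid.intro
        abelian_group_axioms.intro 1 comm_group.axioms(1)[OF 1] M.R.ring_axioms)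
qed

lemma right_module_hom_restrict:
  assumes "f \<in> right_module_hom R M N" "H \<subseteq> carrier M"
  shows "f \<in> right_module_hom R (M\<lparr>carrier := H\<rparr>) N"
  using assms right_module_homD[OF assms(1)] by (intro right_module_homI) (simp_all add: subset_iff)

lemma right_module_hom_diff:
  assumes M: "right_module R M" and N: "right_module R N"
    and f: "f \<in> right_module_hom R M N" and x: "x \<in> carrier M" and y: "y \<in> carrier M"
  shows "f (x \<ominus>\<^bsub>M\<^esub> y) = f x \<ominus>\<^bsub>N\<^esub> f y"
proof -
  interpret M: right_module R M by fact
  interpret N: right_module R N by fact
  have "f (x \<ominus>\<^bsub>M\<^esub> y) \<oplus>\<^bsub>N\<^esub> f y = f x"
    using right_module_homD(2)[OF f, of "x \<ominus>\<^bsub>M\<^esub> y" y] x y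
    by (simp add: a_minus_def M.M.a_assoc M.M.l_neg)
  then show ?thesis
    using N.M.minus_eq_iff[of "f x" "f y" "f (x \<ominus>\<^bsub>M\<^esub> y)"] x y right_module_homD(1)[OF f] by simp
qed

lemma right_module_hom_add:
  assumes N: "right_module R N"
    and f: "f \<in> right_module_hom R M N" and g: "g \<in> right_module_hom R M N"
  shows "(\<lambda>x. f x \<oplus>\<^bsub>N\<^esub> g x) \<in> right_module_hom R M N"
proof -
  interpret N: right_module R N by fact
  note [simp] = right_module_homD[OF f] right_module_homD[OF g]
  show ?thesis
    by (rule right_module_homI) (simp_all add: N.M.a_ac N.smult_r_distr)
qed

lemma right_module_hom_sub:
  assumes N: "right_module R N"
    and f: "f \<in> right_module_hom R M N" and g: "g \<in> right_module_hom R M N"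
  shows "(\<lambda>x. f x \<ominus>\<^bsub>N\<^esub> g x) \<in> right_module_hom R M N"
proof -
  interpret N: right_module R N by fact
  have neg: "\<ominus>\<^bsub>N\<^esub> (a \<odot>\<^bsub>N\<^esub> y) = a \<odot>\<^bsub>N\<^esub> (\<ominus>\<^bsub>N\<^esub> y)" if "a \<in> carrier R" "y \<in> carrier N" for a y
    using that N.smult_r_distr[of a "\<ominus>\<^bsub>N\<^esub> y" y]
    by (intro N.M.minus_equality) (simp_all add: N.M.l_neg N.smult_r_zero)
  have "(\<lambda>x. \<ominus>\<^bsub>N\<^esub> g x) \<in> right_module_hom R M N"
    by (rule right_module_homI)
      (simp_all add: right_module_homD[OF g] N.M.minus_add neg)
  from right_module_hom_add[OF N f this] show ?thesis by (simp add: a_minus_def)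
qed

text \<open>\<open>f\<close> is constant on the fibres of \<open>p\<close>, so its composite with a
  section of \<open>p\<close> does not depend on the section. The factor map lives on the image
  because \<open>p\<close> will be a projection restricted to a submodule, which need not be
  onto.\<close>

lemma right_module_hom_factor:
  assumes M: "right_module R M"
    and p: "p \<in> right_module_hom R M N" and f: "f \<in> right_module_hom R M P"
    and ker: "\<And>x y. x \<in> carrier M \<Longrightarrow> y \<in> carrier M \<Longrightarrow> p x = p y \<Longrightarrow> f x = f y"
  obtains f' where "f' \<in> right_module_hom R (N\<lparr>carrier := p ` carrier M\<rparr>) P"
    and "\<And>x. x \<in> carrier M \<Longrightarrow> f' (p x) = f x"
proof -
  interpret M: right_module R M by fact
  define f' where "f' = f \<circ> inv_into (carrier M) p"
  have f': "f' (p x) = f x" if "x \<in> carrier M" for x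
    unfolding f'_def comp_def
    by (rule ker) (use that in \<open>auto simp: inv_into_into f_inv_into_f\<close>)
  have "f' \<in> right_module_hom R (N\<lparr>carrier := p ` carrier M\<rparr>) P"
    by (rule right_module_homI)
      (use right_module_homD[OF f] right_module_homD[OF p] f' in
        \<open>auto simp flip: right_module_homD(2)[OF p] right_module_homD(3)[OF p]\<close>)
  then show thesis using f' by (rule that)
qed

text \<open>Hides the cosets: later arguments reach the elements of a quotient only through these
  properties of the projection.\<close>

lemma quotient_right_module_proj:
  assumes M: "right_module R M" and A: "submodule A R M"
  obtains p where "p \<in> right_module_hom R M (quotient_right_module M A)"
    and "p ` carrier M = carrier (quotient_right_module M A)"
    and "\<And>x y. x \<in> carrier M \<Longrightarrow> y \<in> carrier M \<Longrightarrow> p x = p y \<longleftrightarrow> x \<ominus>\<^bsub>M\<^esub> y \<in> A"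
proof -
  interpret M: right_module R M by fact
  have sg: "subgroup A (add_monoid M)" using A by (simp add: submodule_def)
  have as: "abelian_subgroup A M"
    by (intro abelian_subgroupI3 additive_subgroup.intro sg M.M.abelian_group_axioms)
  interpret A: abelian_subgroup A M by (rule as)
  let ?p = "\<lambda>x. A +>\<^bsub>M\<^esub> x"
  show thesis
  proof (rule that[of ?p])
    show "?p ` carrier M = carrier (quotient_right_module M A)"
      by (auto simp: quotient_right_module_def A_RCOSETS_def RCOSETS_def a_r_coset_def)
    then show "?p \<in> right_module_hom R M (quotient_right_module M A)"
      by (intro right_module_homI)
        (auto simp: quotient_right_module_def A.a_rcos_sum M.coset_smult[OF A])
    fix x y assume xy: "x \<in> carrier M" "y \<in> carrier M"
    have "?p x = ?p y \<longleftrightarrow> x \<in> ?p y"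
      using M.M.a_repr_independence[of x A y] A.a_rcos_self[OF xy(1)] xy sg by auto
    also have "\<dots> \<longleftrightarrow> x \<ominus>\<^bsub>M\<^esub> y \<in> A"
      using A.a_rcos_module[OF xy(2,1)] by (simp add: a_minus_def)
    finally show "?p x = ?p y \<longleftrightarrow> x \<ominus>\<^bsub>M\<^esub> y \<in> A" .
  qed
qed

subsection \<open>Injectivity relative to quotients\<close>

text \<open>Since \<open>f\<close> vanishes on \<open>H \<inter> A\<close>, it factors through the
  image \<open>(H + A)/A\<close> of \<open>H\<close> in \<open>M/A\<close>. The induced map extends
  to \<open>M/A\<close>, and composing the extension with the projection gives
  \<open>g\<close>.\<close>

lemma relatively_injective_quotientD:
  assumes M: "right_module R M" and S: "right_module R S" and A: "submodule A R M"
    and inj: "relatively_injective R (quotient_right_module M A) S"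
    and H: "submodule H R M" and f: "f \<in> right_module_hom R (M\<lparr>carrier := H\<rparr>) S"
    and ker: "\<And>x. x \<in> H \<inter> A \<Longrightarrow> f x = \<zero>\<^bsub>S\<^esub>"
  obtains g where "g \<in> right_module_hom R M S" "\<And>x. x \<in> H \<Longrightarrow> g x = f x"
    "\<And>x. x \<in> A \<Longrightarrow> g x = \<zero>\<^bsub>S\<^esub>"
proof -
  interpret M: right_module R M by fact
  interpret S: right_module R S by fact
  interpret H: right_module R "M\<lparr>carrier := H\<rparr>" by (rule right_module_submodule[OF M H])
  let ?Q = "quotient_right_module M A"
  have Q: "right_module R ?Q" by (rule M.right_module_quotient[OF A])
  obtain p where p: "p \<in> right_module_hom R M ?Q"
    and p_eq: "\<And>x y. x \<in> carrier M \<Longrightarrow> y \<in> carrier M \<Longrightarrow> p x = p y \<longleftrightarrow> x \<ominus>\<^bsub>M\<^esub> y \<in> A"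
    using quotient_right_module_proj[OF M A] by metis
  note Hc = right_submoduleD(1)[OF H]
  \<comment> \<open>Negation in \<open>M\<lparr>carrier := H\<rparr>\<close> is an inverse taken
    within \<open>H\<close>, so it is not literally that of \<open>M\<close>; the inclusion, being a
    homomorphism, carries one difference to the other.\<close>
  have dH: "x \<ominus>\<^bsub>M\<^esub> y \<in> H \<and> f (x \<ominus>\<^bsub>M\<^esub> y) = f x \<ominus>\<^bsub>S\<^esub> f y" if "x \<in> H" "y \<in> H" for x y
  proof -
    have "x \<ominus>\<^bsub>M\<lparr>carrier := H\<rparr>\<^esub> y = x \<ominus>\<^bsub>M\<^esub> y"
      using right_module_hom_diff[OF H.right_module_axioms M right_module_hom_restrict[OF _ Hc], of id] that
      by (simp add: right_module_homI)
    then show ?thesis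
      using H.M.minus_closed[of x y] right_module_hom_diff[OF H.right_module_axioms S f, of x y] that
      by simp
  qed
  have carrH: "carrier (M\<lparr>carrier := H\<rparr>) = H" by simp
  have wd: "f x = f y"
    if xy: "x \<in> carrier (M\<lparr>carrier := H\<rparr>)" "y \<in> carrier (M\<lparr>carrier := H\<rparr>)"
      and eq: "p x = p y" for x y
  proof -
    note that = xy[unfolded carrH] eq
    have "x \<ominus>\<^bsub>M\<^esub> y \<in> A" using p_eq that Hc by blast
    then have "f x \<ominus>\<^bsub>S\<^esub> f y = \<zero>\<^bsub>S\<^esub>" using ker dH that by force
    then show ?thesis
      using right_module_homD(1)[OF f] that S.M.minus_eq_iff[of "f x" "f y" "\<zero>\<^bsub>S\<^esub>"] by simp
  qed
  obtain f' where f': "f' \<in> right_module_hom R (?Q\<lparr>carrier := p ` H\<rparr>) S"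
    and f'p: "\<And>x. x \<in> H \<Longrightarrow> f' (p x) = f x"
    using right_module_hom_factor[OF H.right_module_axioms right_module_hom_restrict[OF p Hc] f wd]
    unfolding carrH by blast
  from inj[unfolded relatively_injective_def, rule_format, OF right_submodule_image[OF M Q p H] f']
  obtain g where g: "g \<in> right_module_hom R ?Q S" and gf': "\<And>X. X \<in> p ` H \<Longrightarrow> g X = f' X"
    by blast
  show thesis
  proof (rule that)
    show "g \<circ> p \<in> right_module_hom R M S" by (rule right_module_hom_comp[OF p g])
    show "(g \<circ> p) x = f x" if "x \<in> H" for x using gf' f'p that by simp
    show "(g \<circ> p) x = \<zero>\<^bsub>S\<^esub>" if "x \<in> A" for x
    proof -
      have xc: "x \<in> carrier M" using right_submoduleD(1)[OF A] that by auto
      then have "p x = p \<zero>\<^bsub>M\<^esub>" using p_eq[of x "\<zero>\<^bsub>M\<^esub>"] M.M.minus_eq_iff[of x "\<zero>\<^bsub>M\<^esub>" x] that by simp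
      then show ?thesis
        using right_module_hom_zero[OF M S right_module_hom_comp[OF p g]] by simp
    qed
  qed
qed

text \<open>
  A module with \<open>A \<inter> B = 0\<close> embeds into \<open>M/A \<oplus> M/B\<close>. The extension is built one summand at a
  time: \<open>g\<close> handles \<open>f\<close> on \<open>H \<inter> B\<close>, and the remainder \<open>f - g\<close> factors through \<open>M/B\<close>.
\<close>

lemma relatively_injective_disjoint_quotients:
  assumes M: "right_module R M" and S: "right_module R S"
    and A: "submodule A R M" and B: "submodule B R M" and AB: "A \<inter> B = {\<zero>\<^bsub>M\<^esub>}"
    and injA: "relatively_injective R (quotient_right_module M A) S"
    and injB: "relatively_injective R (quotient_right_module M B) S"
  shows "relatively_injective R M S"
  unfolding relatively_injective_def
proof (intro allI impI ballI)
  fix H f assume H: "submodule H R M" and f: "f \<in> right_module_hom R (M\<lparr>carrier := H\<rparr>) S"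
  interpret M: right_module R M by fact
  interpret S: right_module R S by fact
  note H' = right_submoduleD[OF H] and B' = right_submoduleD[OF B]
  have HB: "submodule (H \<inter> B) R M"
    by (rule right_submoduleI[OF M]) (use H' B' in auto)
  have fHB: "f \<in> right_module_hom R (M\<lparr>carrier := H \<inter> B\<rparr>) S"
    using right_module_hom_restrict[OF f, of "H \<inter> B"] by simp
  \<comment> \<open>Because \<open>A\<close> and \<open>B\<close> meet in zero, the vanishing
    condition holds, and \<open>f\<close> restricted to \<open>H \<inter> B\<close> extends through
    \<open>M/A\<close>.\<close>
  have "f x = \<zero>\<^bsub>S\<^esub>" if "x \<in> (H \<inter> B) \<inter> A" for x
  proof -
    have "x = \<zero>\<^bsub>M\<^esub>" using that AB by auto
    then show ?thesis
      using right_module_hom_zero[OF right_module_submodule[OF M H] S f] by simp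
  qed
  then obtain g where g: "g \<in> right_module_hom R M S" "\<And>x. x \<in> H \<inter> B \<Longrightarrow> g x = f x"
    using relatively_injective_quotientD[OF M S A injA HB fHB] by metis
  note gH = right_module_hom_restrict[OF g(1) H'(1)]
  have d: "(\<lambda>x. f x \<ominus>\<^bsub>S\<^esub> g x) \<in> right_module_hom R (M\<lparr>carrier := H\<rparr>) S"
    by (rule right_module_hom_sub[OF S f gH])
  have d0: "f x \<ominus>\<^bsub>S\<^esub> g x = \<zero>\<^bsub>S\<^esub>" if "x \<in> H \<inter> B" for x
    using g(2)[OF that] right_module_homD(1)[OF gH, of x] that
    by (simp add: a_minus_def S.M.r_neg)
  obtain k where k: "k \<in> right_module_hom R M S"
    "\<And>x. x \<in> H \<Longrightarrow> k x = f x \<ominus>\<^bsub>S\<^esub> g x"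
    using relatively_injective_quotientD[OF M S B injB H d d0] by blast
  have "k x \<oplus>\<^bsub>S\<^esub> g x = f x" if "x \<in> H" for x
    using k(2)[OF that] right_module_homD(1)[OF gH, of x] right_module_homD(1)[OF f, of x] that
    by (simp add: a_minus_def S.M.a_assoc S.M.l_neg)
  then show "\<exists>g\<in>right_module_hom R M S. \<forall>x\<in>H. g x = f x"
    using right_module_hom_add[OF S k(1) g(1)] by (intro bexI[of _ "\<lambda>x. k x \<oplus>\<^bsub>S\<^esub> g x"]) auto
qed

subsection \<open>Baer's criterion\<close>

lemma (in right_module) smult_l_zero: "x \<in> carrier M \<Longrightarrow> \<zero>\<^bsub>R\<^esub> \<odot>\<^bsub>M\<^esub> x = \<zero>\<^bsub>M\<^esub>"
  using smult_l_distr[of "\<zero>\<^bsub>R\<^esub>" "\<zero>\<^bsub>R\<^esub>" x]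
  by (metis R.zero_closed R.r_zero smult_closed M.add.l_cancel_one)

lemma (in right_module) smult_minus_one:
  assumes "x \<in> carrier M" shows "(\<ominus>\<^bsub>R\<^esub> \<one>\<^bsub>R\<^esub>) \<odot>\<^bsub>M\<^esub> x = \<ominus>\<^bsub>M\<^esub> x"
  using smult_l_distr[of "\<ominus>\<^bsub>R\<^esub> \<one>\<^bsub>R\<^esub>" "\<one>\<^bsub>R\<^esub>" x] assms
  by (intro M.minus_equality[symmetric]) (simp_all add: R.l_neg smult_l_zero)

text \<open>As graphs, partial homomorphisms are ordered by inclusion, and a chain is bounded by its
  plain union. Single-valuedness is demanded at zero only: the action of \<open>-1\<close> gives
  closure under differences, and the general case follows.\<close>

definition partial_hom_graph ::
    "('a, 'm) ring_scheme \<Rightarrow> ('a, 'b, 'k) module_scheme \<Rightarrow> ('a, 'c, 'l) module_scheme \<Rightarrow>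
      ('b \<times> 'c) set \<Rightarrow> bool"
  where "partial_hom_graph R N S G \<longleftrightarrow>
    G \<subseteq> carrier N \<times> carrier S \<and> (\<zero>\<^bsub>N\<^esub>, \<zero>\<^bsub>S\<^esub>) \<in> G \<and>
    (\<forall>x s y t. (x, s) \<in> G \<longrightarrow> (y, t) \<in> G \<longrightarrow> (x \<oplus>\<^bsub>N\<^esub> y, s \<oplus>\<^bsub>S\<^esub> t) \<in> G) \<and>
    (\<forall>a\<in>carrier R. \<forall>x s. (x, s) \<in> G \<longrightarrow> (a \<odot>\<^bsub>N\<^esub> x, a \<odot>\<^bsub>S\<^esub> s) \<in> G) \<and>
    (\<forall>s. (\<zero>\<^bsub>N\<^esub>, s) \<in> G \<longrightarrow> s = \<zero>\<^bsub>S\<^esub>)"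

lemma partial_hom_graphD:
  assumes "partial_hom_graph R N S G"
  shows "(x, s) \<in> G \<Longrightarrow> x \<in> carrier N" "(x, s) \<in> G \<Longrightarrow> s \<in> carrier S"
    "(\<zero>\<^bsub>N\<^esub>, \<zero>\<^bsub>S\<^esub>) \<in> G"
    "(x, s) \<in> G \<Longrightarrow> (y, t) \<in> G \<Longrightarrow> (x \<oplus>\<^bsub>N\<^esub> y, s \<oplus>\<^bsub>S\<^esub> t) \<in> G"
    "a \<in> carrier R \<Longrightarrow> (x, s) \<in> G \<Longrightarrow> (a \<odot>\<^bsub>N\<^esub> x, a \<odot>\<^bsub>S\<^esub> s) \<in> G"
    "(\<zero>\<^bsub>N\<^esub>, s) \<in> G \<Longrightarrow> s = \<zero>\<^bsub>S\<^esub>"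
  using assms unfolding partial_hom_graph_def by blast+

lemma partial_hom_graph_minus:
  assumes N: "right_module R N" and S: "right_module R S" and G: "partial_hom_graph R N S G"
    and xs: "(x, s) \<in> G"
  shows "(\<ominus>\<^bsub>N\<^esub> x, \<ominus>\<^bsub>S\<^esub> s) \<in> G"
proof -
  interpret N: right_module R N by fact
  interpret S: right_module R S by fact
  show ?thesis
    using partial_hom_graphD(5)[OF G _ xs, of "\<ominus>\<^bsub>R\<^esub> \<one>\<^bsub>R\<^esub>"] partial_hom_graphD(1,2)[OF G xs]
    by (simp add: N.smult_minus_one S.smult_minus_one)
qed

lemma partial_hom_graph_unique:
  assumes N: "right_module R N" and S: "right_module R S" and G: "partial_hom_graph R N S G"
    and xs: "(x, s) \<in> G" and xt: "(x, t) \<in> G"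
  shows "s = t"
proof -
  interpret N: right_module R N by fact
  interpret S: right_module R S by fact
  note c = partial_hom_graphD(1,2)[OF G xs] partial_hom_graphD(2)[OF G xt]
  have "(x \<oplus>\<^bsub>N\<^esub> \<ominus>\<^bsub>N\<^esub> x, s \<oplus>\<^bsub>S\<^esub> \<ominus>\<^bsub>S\<^esub> t) \<in> G"
    by (rule partial_hom_graphD(4)[OF G xs partial_hom_graph_minus[OF N S G xt]])
  then have "s \<ominus>\<^bsub>S\<^esub> t = \<zero>\<^bsub>S\<^esub>"
    using partial_hom_graphD(6)[OF G] c by (simp add: N.M.r_neg a_minus_def)
  then show ?thesis using S.M.minus_eq_iff[of s t "\<zero>\<^bsub>S\<^esub>"] c by simp
qed

text \<open>By uniqueness of values, the chosen ones respect the operations. The map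
  \<open>p\<close> serves two cases: the multiples \<open>r \<odot> x\<close> of one element with
  \<open>r\<close> in a right ideal, and the identity once the graph is total.\<close>

lemma partial_hom_graph_hom:
  assumes N: "right_module R N" and S: "right_module R S" and G: "partial_hom_graph R N S G"
    and p: "p \<in> right_module_hom R P N" and total: "\<And>x. x \<in> carrier P \<Longrightarrow> \<exists>t. (p x, t) \<in> G"
  obtains g where "g \<in> right_module_hom R P S" "\<And>x. x \<in> carrier P \<Longrightarrow> (p x, g x) \<in> G"
proof -
  define g where "g x = (SOME t. (p x, t) \<in> G)" for x
  have g: "(p x, g x) \<in> G" if "x \<in> carrier P" for x
    unfolding g_def using total[OF that] by (rule someI_ex)
  have g_eq: "(p x, t) \<in> G \<Longrightarrow> g x = t" for x t
    unfolding g_def using partial_hom_graph_unique[OF N S G] by blast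
  note p' = right_module_homD[OF p]
  have "g \<in> right_module_hom R P S"
    by (rule right_module_homI)
      (auto intro!: g_eq partial_hom_graphD(4,5)[OF G] g simp: p' intro: partial_hom_graphD(2)[OF G g])
  then show thesis using g by (rule that)
qed

text \<open>The core of Baer's argument: the multiples of \<open>x\<close> in the domain of
  \<open>G\<close> correspond to a right ideal \<open>I\<close>, and injectivity relative to the
  ring provides a consistent value for \<open>x\<close>.\<close>

lemma partial_hom_graph_extend:
  assumes N: "right_module R N" and S: "right_module R S"
    and inj: "relatively_injective R (regular_right_module R) S"
    and G: "partial_hom_graph R N S G" and x: "x \<in> carrier N"
  obtains G' t where "partial_hom_graph R N S G'" "G \<subseteq> G'" "(x, t) \<in> G'"
proof -
  interpret N: right_module R N by fact
  interpret S: right_module R S by fact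
  have RR: "right_module R (regular_right_module R)"
    by (rule right_module_regular) (rule N.R.ring_axioms)
  note G' = partial_hom_graphD[OF G]
  define I where "I = {r \<in> carrier R. \<exists>t. (r \<odot>\<^bsub>N\<^esub> x, t) \<in> G}"
  have I: "right_ideal I R"
  proof (rule right_submoduleI[OF RR])
    show "\<zero>\<^bsub>regular_right_module R\<^esub> \<in> I" using x G'(3) by (auto simp: I_def N.smult_l_zero)
    show "u \<oplus>\<^bsub>regular_right_module R\<^esub> v \<in> I" if "u \<in> I" "v \<in> I" for u v
      using that x by (auto simp: I_def N.smult_l_distr intro: G'(4))
    show "a \<odot>\<^bsub>regular_right_module R\<^esub> u \<in> I" if "a \<in> carrier R" "u \<in> I" for a u
      using that x by (auto simp: I_def N.smult_assoc1 intro: G'(5))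
  qed (auto simp: I_def)
  have p: "(\<lambda>r. r \<odot>\<^bsub>N\<^esub> x) \<in> right_module_hom R ((regular_right_module R)\<lparr>carrier := I\<rparr>) N"
    by (rule right_module_homI)
      (use x in \<open>simp_all add: I_def N.smult_l_distr N.smult_assoc1\<close>)
  obtain h where h: "h \<in> right_module_hom R ((regular_right_module R)\<lparr>carrier := I\<rparr>) S"
    "\<And>r. r \<in> I \<Longrightarrow> (r \<odot>\<^bsub>N\<^esub> x, h r) \<in> G"
  proof (rule partial_hom_graph_hom[OF N S G p])
    show "\<exists>t. (r \<odot>\<^bsub>N\<^esub> x, t) \<in> G"
      if "r \<in> carrier ((regular_right_module R)\<lparr>carrier := I\<rparr>)" for r
      using that by (simp add: I_def)
  qed simp
  from inj[unfolded relatively_injective_def, rule_format, OF I h(1)]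
  obtain k where k: "k \<in> right_module_hom R (regular_right_module R) S" "\<And>r. r \<in> I \<Longrightarrow> k r = h r"
    by blast
  \<comment> \<open>A homomorphism on the regular module is determined by its value at one, so
    \<open>s\<close> is the value to assign to \<open>x\<close>.\<close>
  define s where "s = k \<one>\<^bsub>R\<^esub>"
  have s: "s \<in> carrier S" using right_module_homD(1)[OF k(1)] by (simp add: s_def)
  have ks: "k r = r \<odot>\<^bsub>S\<^esub> s" if "r \<in> carrier R" for r
    using right_module_homD(3)[OF k(1) that, of "\<one>\<^bsub>R\<^esub>"] that by (simp add: s_def)
  have rs: "t = r \<odot>\<^bsub>S\<^esub> s" if "r \<in> carrier R" "(r \<odot>\<^bsub>N\<^esub> x, t) \<in> G" for r t
  proof -
    have "r \<in> I" using that by (auto simp: I_def)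
    then show ?thesis
      using partial_hom_graph_unique[OF N S G that(2) h(2)] k(2) ks[OF that(1)] by metis
  qed
  \<comment> \<open>\<open>E\<close> is the sum of \<open>G\<close> and the graph generated by
    \<open>(x, s)\<close>.\<close>
  define E where "E = {(d \<oplus>\<^bsub>N\<^esub> r \<odot>\<^bsub>N\<^esub> x, t \<oplus>\<^bsub>S\<^esub> r \<odot>\<^bsub>S\<^esub> s) | d t r. (d, t) \<in> G \<and> r \<in> carrier R}"
  have EI: "(u, v) \<in> E"
    if "(d, t) \<in> G" "r \<in> carrier R" "u = d \<oplus>\<^bsub>N\<^esub> r \<odot>\<^bsub>N\<^esub> x" "v = t \<oplus>\<^bsub>S\<^esub> r \<odot>\<^bsub>S\<^esub> s" for u v d t r
    using that by (auto simp: E_def)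
  have EE: "\<exists>d t r. (d, t) \<in> G \<and> r \<in> carrier R \<and> d \<in> carrier N \<and> t \<in> carrier S \<and>
      u = d \<oplus>\<^bsub>N\<^esub> r \<odot>\<^bsub>N\<^esub> x \<and> v = t \<oplus>\<^bsub>S\<^esub> r \<odot>\<^bsub>S\<^esub> s" if "(u, v) \<in> E" for u v
    using that G'(1,2) by (auto simp: E_def) blast
  have GE: "G \<subseteq> E"
  proof (rule subrelI)
    fix d t assume dt: "(d, t) \<in> G"
    show "(d, t) \<in> E"
      by (rule EI[OF dt, of "\<zero>\<^bsub>R\<^esub>"]) (use G'(1,2)[OF dt] x s in \<open>simp_all add: N.smult_l_zero S.smult_l_zero\<close>)
  qed
  have xE: "(x, s) \<in> E"
    by (rule EI[OF G'(3), of "\<one>\<^bsub>R\<^esub>"]) (use x s in simp_all)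
  have "partial_hom_graph R N S E"
    unfolding partial_hom_graph_def
  proof (intro conjI allI ballI impI)
    show "E \<subseteq> carrier N \<times> carrier S" using G'(1,2) x s by (auto simp: E_def)
    show "(\<zero>\<^bsub>N\<^esub>, \<zero>\<^bsub>S\<^esub>) \<in> E" using GE G'(3) by blast
  next
    fix u v u' v' assume uv: "(u, v) \<in> E" "(u', v') \<in> E"
    obtain d t r where 1: "(d, t) \<in> G" "r \<in> carrier R" "d \<in> carrier N" "t \<in> carrier S"
      "u = d \<oplus>\<^bsub>N\<^esub> r \<odot>\<^bsub>N\<^esub> x" "v = t \<oplus>\<^bsub>S\<^esub> r \<odot>\<^bsub>S\<^esub> s" using EE[OF uv(1)] by blast
    obtain d' t' r' where 2: "(d', t') \<in> G" "r' \<in> carrier R" "d' \<in> carrier N" "t' \<in> carrier S"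
      "u' = d' \<oplus>\<^bsub>N\<^esub> r' \<odot>\<^bsub>N\<^esub> x" "v' = t' \<oplus>\<^bsub>S\<^esub> r' \<odot>\<^bsub>S\<^esub> s" using EE[OF uv(2)] by blast
    show "(u \<oplus>\<^bsub>N\<^esub> u', v \<oplus>\<^bsub>S\<^esub> v') \<in> E"
      by (rule EI[OF G'(4)[OF 1(1) 2(1)], of "r \<oplus>\<^bsub>R\<^esub> r'"])
        (use 1 2 x s in \<open>simp_all add: N.smult_l_distr S.smult_l_distr N.M.a_ac S.M.a_ac\<close>)
  next
    fix a u v assume a: "a \<in> carrier R" and uv: "(u, v) \<in> E"
    obtain d t r where 1: "(d, t) \<in> G" "r \<in> carrier R" "d \<in> carrier N" "t \<in> carrier S"
      "u = d \<oplus>\<^bsub>N\<^esub> r \<odot>\<^bsub>N\<^esub> x" "v = t \<oplus>\<^bsub>S\<^esub> r \<odot>\<^bsub>S\<^esub> s" using EE[OF uv] by blast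
    show "(a \<odot>\<^bsub>N\<^esub> u, a \<odot>\<^bsub>S\<^esub> v) \<in> E"
      by (rule EI[OF G'(5)[OF a 1(1)], of "r \<otimes>\<^bsub>R\<^esub> a"])
        (use 1 a x s in \<open>simp_all add: N.smult_r_distr S.smult_r_distr N.smult_assoc1 S.smult_assoc1\<close>)
  next
    \<comment> \<open>If \<open>d \<oplus> r \<odot> x\<close> is zero, then
      \<open>r \<odot> x\<close> already lies in the domain of \<open>G\<close>, with value
      \<open>\<ominus> t\<close>. By \<open>rs\<close> that value is \<open>r \<odot> s\<close>, so
      the two parts of \<open>v\<close> cancel.\<close>
    fix v assume "(\<zero>\<^bsub>N\<^esub>, v) \<in> E"
    then obtain d t r where 1: "(d, t) \<in> G" "r \<in> carrier R" "d \<in> carrier N" "t \<in> carrier S"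
      "\<zero>\<^bsub>N\<^esub> = d \<oplus>\<^bsub>N\<^esub> r \<odot>\<^bsub>N\<^esub> x" "v = t \<oplus>\<^bsub>S\<^esub> r \<odot>\<^bsub>S\<^esub> s" using EE by blast
    have "\<ominus>\<^bsub>N\<^esub> d = r \<odot>\<^bsub>N\<^esub> x"
      using 1 x by (intro N.M.minus_equality) (simp_all add: N.M.a_comm)
    then have "(r \<odot>\<^bsub>N\<^esub> x, \<ominus>\<^bsub>S\<^esub> t) \<in> G" using partial_hom_graph_minus[OF N S G 1(1)] by simp
    then have "r \<odot>\<^bsub>S\<^esub> s = \<ominus>\<^bsub>S\<^esub> t" using rs[OF 1(2)] by simp
    then show "v = \<zero>\<^bsub>S\<^esub>" using 1 by (simp add: S.M.r_neg)
  qed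
  then show thesis using GE xE by (rule that)
qed

lemma partial_hom_graph_Union_chain:
  assumes C: "C \<noteq> {}" "subset.chain {G. partial_hom_graph R N S G \<and> F \<subseteq> G} C"
  shows "\<Union>C \<in> {G. partial_hom_graph R N S G \<and> F \<subseteq> G}"
proof -
  have D: "partial_hom_graph R N S G" "F \<subseteq> G" if "G \<in> C" for G
    using C(2) that by (auto simp: subset_chain_def)
  \<comment> \<open>Two members of a chain lie in a common one, so closure under addition can be
    checked inside a single graph.\<close>
  have join: "\<exists>K\<in>C. G \<subseteq> K \<and> H \<subseteq> K" if "G \<in> C" "H \<in> C" for G H
  proof -
    have "G \<subseteq> H \<or> H \<subseteq> G" using C(2) that by (simp add: subset_chain_def)
    then show ?thesis using that by blast
  qed
  have "partial_hom_graph R N S (\<Union>C)"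
    unfolding partial_hom_graph_def
  proof (intro conjI allI ballI impI)
    show "\<Union>C \<subseteq> carrier N \<times> carrier S" using partial_hom_graphD(1,2)[OF D(1)] by fastforce
    show "(\<zero>\<^bsub>N\<^esub>, \<zero>\<^bsub>S\<^esub>) \<in> \<Union>C" using C(1) partial_hom_graphD(3)[OF D(1)] by blast
  next
    fix x s y t assume "(x, s) \<in> \<Union>C" "(y, t) \<in> \<Union>C"
    then obtain K where "K \<in> C" "(x, s) \<in> K" "(y, t) \<in> K" using join by blast
    then show "(x \<oplus>\<^bsub>N\<^esub> y, s \<oplus>\<^bsub>S\<^esub> t) \<in> \<Union>C" using partial_hom_graphD(4)[OF D(1)] by blast
  next
    fix a x s assume "a \<in> carrier R" "(x, s) \<in> \<Union>C"
    then show "(a \<odot>\<^bsub>N\<^esub> x, a \<odot>\<^bsub>S\<^esub> s) \<in> \<Union>C" using partial_hom_graphD(5)[OF D(1)] by blast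
  next
    fix s assume "(\<zero>\<^bsub>N\<^esub>, s) \<in> \<Union>C"
    then show "s = \<zero>\<^bsub>S\<^esub>" using partial_hom_graphD(6)[OF D(1)] by blast
  qed
  moreover have "F \<subseteq> \<Union>C" using C(1) D(2) by blast
  ultimately show ?thesis by simp
qed

text \<open>Zorn's lemma gives a maximal graph containing that of \<open>f\<close>, and
  \<open>partial_hom_graph_extend\<close> forces it to be total.\<close>

lemma Baer_criterion:
  assumes N: "right_module R N" and S: "right_module R S"
    and inj: "relatively_injective R (regular_right_module R) S"
  shows "relatively_injective R N S"
  unfolding relatively_injective_def
proof (intro allI impI ballI)
  fix H f assume H: "submodule H R N" and f: "f \<in> right_module_hom R (N\<lparr>carrier := H\<rparr>) S"
  interpret N: right_module R N by fact
  interpret S: right_module R S by fact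
  note H' = right_submoduleD[OF H] and f' = right_module_homD[OF f, simplified]
  have f0: "f \<zero>\<^bsub>N\<^esub> = \<zero>\<^bsub>S\<^esub>"
    using right_module_hom_zero[OF right_module_submodule[OF N H] S f] by simp
  define F where "F = {(x, f x) | x. x \<in> H}"
  let ?\<G> = "{G. partial_hom_graph R N S G \<and> F \<subseteq> G}"
  have "partial_hom_graph R N S F"
    unfolding partial_hom_graph_def F_def using H' f' f0 by auto
  then have "?\<G> \<noteq> {}" by blast
  from subset_Zorn_nonempty[OF this partial_hom_graph_Union_chain]
  obtain G where "G \<in> ?\<G>" and max': "\<forall>X\<in>?\<G>. G \<subseteq> X \<longrightarrow> X = G" by blast
  then have G: "partial_hom_graph R N S G" "F \<subseteq> G" by simp_all
  have max: "G' = G" if "partial_hom_graph R N S G'" "G \<subseteq> G'" for G'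
    using max' that G(2) by simp
  have total: "\<exists>t. (x, t) \<in> G" if "x \<in> carrier N" for x
    using partial_hom_graph_extend[OF N S inj G(1) that] max by metis
  have id: "(\<lambda>x. x) \<in> right_module_hom R N N" by (rule right_module_homI) simp_all
  obtain g where g: "g \<in> right_module_hom R N S" "\<And>x. x \<in> carrier N \<Longrightarrow> (x, g x) \<in> G"
    using partial_hom_graph_hom[OF N S G(1) id total] by blast
  have "g x = f x" if "x \<in> H" for x
  proof -
    have "(x, f x) \<in> G" "(x, g x) \<in> G" using that G(2) g(2) H'(1) by (auto simp: F_def)
    then show ?thesis by (rule partial_hom_graph_unique[OF N S G(1), symmetric])
  qed
  with g(1) show "\<exists>g\<in>right_module_hom R N S. \<forall>x\<in>H. g x = f x" by blast
qed

subsection \<open>Proper quotients isomorphic to the ring\<close>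

text \<open>The composite \<open>R \<rightarrow> R/L \<rightarrow> R\<close> is right linear, hence
  left multiplication by the image \<open>x\<close> of one. Its kernel is \<open>L\<close>, and its
  surjectivity gives \<open>y\<close>.\<close>

lemma quotient_isomorphic_regularE:
  assumes R: "ring R" and L: "right_ideal L R"
    and iso: "right_module_isomorphic R
      (quotient_right_module (regular_right_module R) L) (regular_right_module R)"
  obtains x y where "x \<in> carrier R" "y \<in> carrier R" "x \<otimes>\<^bsub>R\<^esub> y = \<one>\<^bsub>R\<^esub>"
    "L = {r \<in> carrier R. x \<otimes>\<^bsub>R\<^esub> r = \<zero>\<^bsub>R\<^esub>}"
proof -
  interpret R: ring R by fact
  let ?R = "regular_right_module R" and ?Q = "quotient_right_module (regular_right_module R) L"
  have RR: "right_module R ?R" by (rule right_module_regular[OF R])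
  interpret RR: right_module R ?R by (rule RR)
  obtain p where p: "p \<in> right_module_hom R ?R ?Q" "p ` carrier R = carrier ?Q"
    and p_eq: "\<And>u v. u \<in> carrier R \<Longrightarrow> v \<in> carrier R \<Longrightarrow> p u = p v \<longleftrightarrow> u \<ominus>\<^bsub>?R\<^esub> v \<in> L"
    using quotient_right_module_proj[OF RR L] by (metis regular_right_module_simps(1))
  obtain f where f: "f \<in> right_module_hom R ?Q ?R" "bij_betw f (carrier ?Q) (carrier R)"
    using iso unfolding right_module_isomorphic_def by auto
  note F = right_module_hom_comp[OF p(1) f(1)]
  define x where "x = f (p \<one>\<^bsub>R\<^esub>)"
  have x: "x \<in> carrier R"
    using right_module_homD(1)[OF F, of "\<one>\<^bsub>R\<^esub>"] by (simp add: x_def)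
  have Fx: "f (p r) = x \<otimes>\<^bsub>R\<^esub> r" if "r \<in> carrier R" for r
    using right_module_homD(3)[OF F that, of "\<one>\<^bsub>R\<^esub>"] that by (simp add: x_def)
  have "\<one>\<^bsub>R\<^esub> \<in> f ` p ` carrier R" using f(2) p(2) by (simp add: bij_betw_def)
  then obtain y where y: "y \<in> carrier R" "x \<otimes>\<^bsub>R\<^esub> y = \<one>\<^bsub>R\<^esub>" using Fx by force
  have "r \<in> L \<longleftrightarrow> x \<otimes>\<^bsub>R\<^esub> r = \<zero>\<^bsub>R\<^esub>" if r: "r \<in> carrier R" for r
  proof -
    have "r \<in> L \<longleftrightarrow> p r = p \<zero>\<^bsub>R\<^esub>"
      using p_eq[OF r, of "\<zero>\<^bsub>R\<^esub>"] RR.M.minus_eq_iff[of r "\<zero>\<^bsub>R\<^esub>" r] r by simp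
    also have "\<dots> \<longleftrightarrow> f (p r) = f (p \<zero>\<^bsub>R\<^esub>)"
      using f(2) right_module_homD(1)[OF p(1)] r by (auto simp: bij_betw_def inj_on_eq_iff)
    finally show ?thesis using Fx r x by simp
  qed
  then have "L = {r \<in> carrier R. x \<otimes>\<^bsub>R\<^esub> r = \<zero>\<^bsub>R\<^esub>}"
    using right_submoduleD(1)[OF L] by auto
  with x y show thesis by (intro that[of x y])
qed

section \<open>Orthogonal idempotents from a one-sided inverse\<close>

locale proper_one_sided_inverse = ring R for R (structure) +
  fixes x y
  assumes x_closed [simp]: "x \<in> carrier R" and y_closed [simp]: "y \<in> carrier R"
    and x_y: "x \<otimes> y = \<one>" and y_x: "y \<otimes> x \<noteq> \<one>"
begin

definition p where "p = \<one> \<ominus> y \<otimes> x"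

text \<open>\<open>w k\<close> generates the same right ideal as the idempotent
  \<open>w k \<otimes> x [^] k\<close>. Left multiplication by \<open>y\<close> shifts the sequence
  up; left multiplication by \<open>x\<close> shifts it down and kills \<open>w 0\<close>.\<close>

definition w where "w k = y [^] (k :: nat) \<otimes> p"

text \<open>
  The elements \<open>e\<^sub>i = y\<^sup>i (1 - y x) x\<^sup>i\<close> are orthogonal idempotents. The set below is the direct sum of
  the right ideals \<open>e\<^sub>i R\<close> over all \<open>i\<close> with \<open>\<not> P i\<close>: the equation expresses \<open>e\<^sub>i r = 0\<close>.
\<close>

definition shift_ideal where
  "shift_ideal P = {r \<in> carrier R. (\<exists>n::nat. x [^] n \<otimes> r = \<zero>) \<and>
    (\<forall>i::nat. P i \<longrightarrow> x [^] i \<otimes> r = y \<otimes> (x [^] Suc i \<otimes> r))}"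

lemma p_closed [simp]: "p \<in> carrier R"
  by (simp add: p_def)

lemma p_nonzero: "p \<noteq> \<zero>"
  using y_x minus_eq_iff[of \<one> "y \<otimes> x" \<zero>] by (auto simp: p_def)

lemma x_p: "x \<otimes> p = \<zero>"
  by (simp add: p_def a_minus_def r_distr r_minus flip: m_assoc) (simp add: x_y r_neg)

lemma w_closed [simp]: "w k \<in> carrier R"
  by (simp add: w_def)

lemma x_pow_Suc: "r \<in> carrier R \<Longrightarrow> x [^] Suc n \<otimes> r = x \<otimes> (x [^] n \<otimes> r)"
  using nat_pow_Suc2[of x n] by (simp add: m_assoc)

lemma x_pow_add: "r \<in> carrier R \<Longrightarrow> x [^] (m + n :: nat) \<otimes> r = x [^] m \<otimes> (x [^] n \<otimes> r)"
  by (simp add: m_assoc flip: nat_pow_mult)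

lemma x_w_Suc: "x \<otimes> w (Suc k) = w k"
proof -
  have "x \<otimes> (y \<otimes> (y [^] k \<otimes> p)) = (x \<otimes> y) \<otimes> (y [^] k \<otimes> p)"
    by (simp add: m_assoc)
  then show ?thesis using nat_pow_Suc2[of y k] by (simp add: w_def m_assoc x_y)
qed

lemma y_w: "y \<otimes> w k = w (Suc k)"
  using nat_pow_Suc2[of y k] by (simp add: w_def m_assoc)

lemma x_pow_w: "x [^] i \<otimes> w (i + k) = w k"
proof (induction i arbitrary: k)
  case (Suc i)
  then show ?case using Suc.IH[of "Suc k"] by (subst x_pow_Suc) (simp_all add: x_w_Suc)
qed simp

lemma w_0: "w 0 = p"
  by (simp add: w_def)

lemma x_pow_w_gt: "k < i \<Longrightarrow> x [^] i \<otimes> w k = \<zero>"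
proof (induction rule: less_Suc_induct)
  case (1 i)
  then show ?case using x_pow_w[of i 0] by (subst x_pow_Suc) (simp_all add: w_0 x_p)
next
  case (2 i j k)
  then show ?case using x_pow_add[of "w i" "k - j" j] by simp
qed

text \<open>If \<open>P i\<close>, then \<open>i \<noteq> k\<close>. For \<open>i < k\<close> the
  shifts turn both sides into \<open>w (k - i)\<close>; for \<open>k < i\<close> both sides
  vanish.\<close>

lemma w_shift_ideal:
  assumes "\<not> P k" shows "w k \<in> shift_ideal P"
  unfolding shift_ideal_def
proof (intro CollectI conjI allI impI)
  show "\<exists>n::nat. x [^] n \<otimes> w k = \<zero>" using x_pow_w_gt by blast
  fix i :: nat assume "P i"
  then consider "i < k" | "k < i" using assms by (cases i k rule: linorder_cases) auto
  then show "x [^] i \<otimes> w k = y \<otimes> (x [^] Suc i \<otimes> w k)"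
  proof cases
    case 1
    then obtain j where "k = Suc i + j" using less_iff_Suc_add by auto
    then show ?thesis
      using x_pow_w[of i "Suc j"] x_pow_w[of "Suc i" j] by (simp add: y_w del: nat_pow_Suc)
  next
    case 2
    then show ?thesis by (simp only: x_pow_w_gt less_SucI y_closed r_null)
  qed
qed simp

lemma right_ideal_shift_ideal: "right_ideal (shift_ideal P) R"
proof (rule right_submoduleI[OF right_module_regular])
  fix r s assume r: "r \<in> shift_ideal P" and s: "s \<in> shift_ideal P"
  then have c: "r \<in> carrier R" "s \<in> carrier R" by (auto simp: shift_ideal_def)
  obtain m n :: nat where "x [^] m \<otimes> r = \<zero>" "x [^] n \<otimes> s = \<zero>"
    using r s by (auto simp: shift_ideal_def)
  \<comment> \<open>Both exponents are enlarged to a common one, so that a single power of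
    \<open>x\<close> kills the sum.\<close>
  then have "x [^] (n + m) \<otimes> r = \<zero>" "x [^] (m + n) \<otimes> s = \<zero>"
    using c by (simp_all add: x_pow_add)
  then have "x [^] (m + n) \<otimes> (r \<oplus> s) = \<zero>"
    using c by (simp add: r_distr add.commute)
  moreover have "x [^] i \<otimes> (r \<oplus> s) = y \<otimes> (x [^] Suc i \<otimes> (r \<oplus> s))" if "P i" for i
  proof -
    have "x [^] i \<otimes> r = y \<otimes> (x [^] Suc i \<otimes> r)" "x [^] i \<otimes> s = y \<otimes> (x [^] Suc i \<otimes> s)"
      using r s that by (auto simp: shift_ideal_def)
    then show ?thesis using c by (simp add: r_distr del: nat_pow_Suc)
  qed
  ultimately show "r \<oplus>\<^bsub>regular_right_module R\<^esub> s \<in> shift_ideal P"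
    using c by (auto simp: shift_ideal_def)
next
  fix a r assume a: "a \<in> carrier R" and r: "r \<in> shift_ideal P"
  have c: "r \<in> carrier R" using r by (auto simp: shift_ideal_def)
  obtain n :: nat where "x [^] n \<otimes> r = \<zero>" using r by (auto simp: shift_ideal_def)
  then have "x [^] n \<otimes> (r \<otimes> a) = \<zero>" using c a by (simp flip: m_assoc)
  moreover have "x [^] i \<otimes> (r \<otimes> a) = y \<otimes> (x [^] Suc i \<otimes> (r \<otimes> a))" if "P i" for i
  proof -
    have "x [^] i \<otimes> r \<otimes> a = y \<otimes> (x [^] Suc i \<otimes> r) \<otimes> a"
      using r that by (simp add: shift_ideal_def)
    then show ?thesis using c a by (simp add: m_assoc del: nat_pow_Suc)
  qed
  ultimately show "a \<odot>\<^bsub>regular_right_module R\<^esub> r \<in> shift_ideal P"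
    using c a by (auto simp: shift_ideal_def)
qed (auto simp: shift_ideal_def ring_axioms)

text \<open>On the intersection the defining equation holds for every \<open>i\<close>. Iterated, it
  gives \<open>r = y [^] i \<otimes> (x [^] i \<otimes> r)\<close>, which is zero once
  \<open>x [^] i\<close> kills \<open>r\<close>.\<close>

lemma shift_ideal_disjoint: "shift_ideal P \<inter> shift_ideal (\<lambda>i. \<not> P i) = {\<zero>}"
proof
  show "shift_ideal P \<inter> shift_ideal (\<lambda>i. \<not> P i) \<subseteq> {\<zero>}"
  proof
    fix r assume r: "r \<in> shift_ideal P \<inter> shift_ideal (\<lambda>i. \<not> P i)"
    then have c: "r \<in> carrier R" by (simp add: shift_ideal_def)
    have step: "x [^] i \<otimes> r = y \<otimes> (x [^] Suc i \<otimes> r)" for i :: nat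
      using r by (cases "P i") (simp_all add: shift_ideal_def)
    have r_eq: "r = y [^] i \<otimes> (x [^] i \<otimes> r)" for i :: nat
    proof (induction i)
      case (Suc i)
      then have "r = y [^] i \<otimes> (y \<otimes> (x [^] Suc i \<otimes> r))" using step by metis
      then show ?case using c by (simp add: m_assoc)
    qed (simp add: c)
    obtain n :: nat where "x [^] n \<otimes> r = \<zero>" using r by (auto simp: shift_ideal_def)
    then show "r \<in> {\<zero>}" using r_eq[of n] by simp
  qed
  show "{\<zero>} \<subseteq> shift_ideal P \<inter> shift_ideal (\<lambda>i. \<not> P i)"
    by (simp add: shift_ideal_def)
qed

text \<open>
  If \<open>R/A \<cong> R\<close>, then \<open>A = g R\<close> for an idempotent \<open>g\<close>, and some \<open>x\<^sup>n\<close> that kills \<open>g\<close> would kill all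
  of \<open>A\<close>.
\<close>

lemma shift_ideal_quotient_not_isomorphic:
  assumes "infinite {k. \<not> P k}"
  shows "\<not> right_module_isomorphic R
    (quotient_right_module (regular_right_module R) (shift_ideal P)) (regular_right_module R)"
proof
  assume "right_module_isomorphic R
    (quotient_right_module (regular_right_module R) (shift_ideal P)) (regular_right_module R)"
  then obtain u v where u: "u \<in> carrier R" and v: "v \<in> carrier R" and uv: "u \<otimes> v = \<one>"
    and A: "shift_ideal P = {r \<in> carrier R. u \<otimes> r = \<zero>}"
    using quotient_isomorphic_regularE[OF ring_axioms right_ideal_shift_ideal] by blast
  \<comment> \<open>As \<open>v\<close> is a right inverse of \<open>u\<close>, left multiplication
    by \<open>g\<close> projects onto the kernel of \<open>u\<close>, which is
    \<open>shift_ideal P\<close>: \<open>g\<close> lies in it and fixes its elements.\<close>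
  define g where "g = \<one> \<ominus> v \<otimes> u"
  have gc: "g \<in> carrier R" using u v by (simp add: g_def)
  have "u \<otimes> g = \<zero>"
    using u v by (simp add: g_def a_minus_def r_distr r_minus flip: m_assoc) (simp add: uv r_neg)
  then have "g \<in> shift_ideal P" using A gc by simp
  then obtain n :: nat where n: "x [^] n \<otimes> g = \<zero>" by (auto simp: shift_ideal_def)
  \<comment> \<open>\<open>P\<close> fails arbitrarily late, so some \<open>w k\<close> in the ideal
    survives \<open>x [^] n\<close>: a further \<open>k - n\<close> factors \<open>x\<close> turn
    the product into \<open>w 0 = p\<close>, which is nonzero.\<close>
  obtain k where k: "n \<le> k" "\<not> P k" using assms by (auto simp: infinite_nat_iff_unbounded_le)
  have "u \<otimes> w k = \<zero>" using w_shift_ideal[of P k] k(2) A by simp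
  then have "g \<otimes> w k = w k"
    using u v by (simp add: g_def a_minus_def l_distr l_minus m_assoc)
  then have "x [^] n \<otimes> w k = (x [^] n \<otimes> g) \<otimes> w k" using gc by (simp add: m_assoc)
  then have "x [^] n \<otimes> w k = \<zero>" using n by simp
  then have "x [^] (k - n + n) \<otimes> w k = \<zero>" by (subst x_pow_add) simp_all
  then have "p = \<zero>" using x_pow_w[of k 0] k(1) by (simp add: w_0)
  then show False using p_nonzero by simp
qed

lemma disjoint_right_ideals:
  obtains A B where "right_ideal A R" "right_ideal B R" "A \<inter> B = {\<zero>}"
    "\<not> right_module_isomorphic R
      (quotient_right_module (regular_right_module R) A) (regular_right_module R)"
    "\<not> right_module_isomorphic R
      (quotient_right_module (regular_right_module R) B) (regular_right_module R)"
proof (rule that)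
  \<comment> \<open>The summands of \<open>shift_ideal P\<close> are indexed by the failures of
    \<open>P\<close>: \<open>shift_ideal even\<close> is the odd part, and the second ideal is the
    even part.\<close>
  have "infinite {k::nat. \<not> even k}" "infinite {k::nat. \<not> \<not> even k}"
    unfolding infinite_nat_iff_unbounded_le
    by (metis (mono_tags) mem_Collect_eq even_Suc le_SucI order_refl)+
  note this[THEN shift_ideal_quotient_not_isomorphic]
  then show "\<not> right_module_isomorphic R
      (quotient_right_module (regular_right_module R) (shift_ideal even)) (regular_right_module R)"
    "\<not> right_module_isomorphic R
      (quotient_right_module (regular_right_module R) (shift_ideal (\<lambda>k. \<not> even k)))
      (regular_right_module R)" by blast+
qed (rule right_ideal_shift_ideal shift_ideal_disjoint)+

end

section \<open>Disjoint right ideals and uniformity\<close>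

lemma proper_quotient_isomorphic_disjoint_right_ideals:
  assumes R: "ring R" and L: "right_ideal L R" "L \<noteq> {\<zero>\<^bsub>R\<^esub>}"
    and iso: "right_module_isomorphic R
      (quotient_right_module (regular_right_module R) L) (regular_right_module R)"
  obtains A B where "right_ideal A R" "right_ideal B R" "A \<inter> B = {\<zero>\<^bsub>R\<^esub>}"
    "\<not> right_module_isomorphic R
      (quotient_right_module (regular_right_module R) A) (regular_right_module R)"
    "\<not> right_module_isomorphic R
      (quotient_right_module (regular_right_module R) B) (regular_right_module R)"
proof -
  interpret R: ring R by fact
  obtain x y where xy: "x \<in> carrier R" "y \<in> carrier R" "x \<otimes>\<^bsub>R\<^esub> y = \<one>\<^bsub>R\<^esub>"
    and L_eq: "L = {r \<in> carrier R. x \<otimes>\<^bsub>R\<^esub> r = \<zero>\<^bsub>R\<^esub>}"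
    using quotient_isomorphic_regularE[OF R L(1) iso] .
  \<comment> \<open>A two-sided inverse would make left multiplication by \<open>x\<close>
    injective, and its kernel \<open>L\<close> would be zero.\<close>
  have "y \<otimes>\<^bsub>R\<^esub> x \<noteq> \<one>\<^bsub>R\<^esub>"
  proof
    assume yx: "y \<otimes>\<^bsub>R\<^esub> x = \<one>\<^bsub>R\<^esub>"
    have "r = \<zero>\<^bsub>R\<^esub>" if "r \<in> carrier R" "x \<otimes>\<^bsub>R\<^esub> r = \<zero>\<^bsub>R\<^esub>" for r
      using that xy yx R.m_assoc[of y x r] by simp
    then show False using L(2) xy(1) by (auto simp: L_eq)
  qed
  then interpret proper_one_sided_inverse R x y
    by unfold_locales (use xy in auto)
  show thesis using disjoint_right_ideals that by blast
qed

text \<open>The WV-property makes a simple module injective relative to \<open>R/A\<close> and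
  \<open>R/B\<close>, hence relative to \<open>R\<close>. Baer's criterion then reaches test modules
  over any type \<open>'n\<close>.\<close>

lemma right_V_ring_if_disjoint_right_ideals:
  fixes R :: "('a, 'm) ring_scheme"
  assumes R: "ring R" and WV: "right_WV_ring TYPE('s) R"
    and A: "right_ideal A R" and B: "right_ideal B R" and AB: "A \<inter> B = {\<zero>\<^bsub>R\<^esub>}"
    and nA: "\<not> right_module_isomorphic R
      (quotient_right_module (regular_right_module R) A) (regular_right_module R)"
    and nB: "\<not> right_module_isomorphic R
      (quotient_right_module (regular_right_module R) B) (regular_right_module R)"
  shows "right_V_ring TYPE('s) TYPE('n) R"
  unfolding right_V_ring_def injective_right_module_def
proof (intro allI impI)
  fix S :: "('a, 's) module" and N :: "('a, 'n) module"
  assume S: "simple_right_module R S" and N: "right_module R N"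
  have S': "right_module R S" using S by (simp add: simple_right_module_def)
  have "relatively_injective R (regular_right_module R) S"
    by (rule relatively_injective_disjoint_quotients[OF right_module_regular[OF R] S' A B])
      (use WV S A B AB nA nB in \<open>auto simp: right_WV_ring_def\<close>)
  then show "relatively_injective R N S" by (rule Baer_criterion[OF N S'])
qed

theorem theorem2:
  fixes R :: "('a, 'm) ring_scheme"
  assumes "ring R"
    and "right_WV_ring TYPE('a set) R"
    and "\<not> right_V_ring TYPE('s) TYPE('n) R"
  shows "uniform_right_module R (regular_right_module R)"
  unfolding uniform_right_module_def
proof (intro conjI allI impI)
  note R = assms(1)
  interpret R: ring R by fact
  let ?R = "regular_right_module R"
  let ?iso = "\<lambda>A. right_module_isomorphic R (quotient_right_module ?R A) ?R"
  show "right_module R ?R" by (rule right_module_regular[OF R])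
  \<comment> \<open>Over a zero ring every module is zero, so there are no simple ones and the
    V-property would hold vacuously.\<close>
  show "carrier ?R \<noteq> {\<zero>\<^bsub>?R\<^esub>}"
  proof
    assume "carrier ?R = {\<zero>\<^bsub>?R\<^esub>}"
    then have one: "\<one>\<^bsub>R\<^esub> = \<zero>\<^bsub>R\<^esub>" using R.one_closed by simp
    have "\<not> simple_right_module R S" for S :: "('a, 's) module"
    proof
      assume S: "simple_right_module R S"
      then interpret S: right_module R S by (simp add: simple_right_module_def)
      have "s = \<zero>\<^bsub>S\<^esub>" if "s \<in> carrier S" for s
        using S.smult_one[OF that] S.smult_l_zero[OF that] one by simp
      then have "carrier S = {\<zero>\<^bsub>S\<^esub>}" by auto
      then show False using S by (simp add: simple_right_module_def)
    qed
    then show False using assms(3) by (simp add: right_V_ring_def)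
  qed
  \<comment> \<open>The WV hypothesis, given for modules on \<open>'a set\<close>, is transferred to
    the type \<open>'s\<close> at which the V-property fails.\<close>
  have not_disjoint: "?iso A \<or> ?iso B"
    if "right_ideal A R" "right_ideal B R" "A \<inter> B = {\<zero>\<^bsub>R\<^esub>}" for A B
    using right_V_ring_if_disjoint_right_ideals[OF R right_WV_ring_all_types[OF assms(2)] that]
      assms(3) by blast
  \<comment> \<open>A nonzero \<open>L\<close> with \<open>R/L\<close> isomorphic to
    \<open>R\<close> would yield a disjoint pair of right ideals with neither quotient isomorphic to
    \<open>R\<close>, against \<open>not_disjoint\<close>.\<close>
  have not_iso: "\<not> ?iso L" if "right_ideal L R" "L \<noteq> {\<zero>\<^bsub>R\<^esub>}" for L
    using proper_quotient_isomorphic_disjoint_right_ideals[OF R that] not_disjoint by metis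
  fix H K assume "right_ideal H R \<and> right_ideal K R \<and> H \<noteq> {\<zero>\<^bsub>?R\<^esub>} \<and> K \<noteq> {\<zero>\<^bsub>?R\<^esub>}"
  then show "H \<inter> K \<noteq> {\<zero>\<^bsub>?R\<^esub>}" using not_disjoint[of H K] not_iso by auto
qed

end
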